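(* Let $S\in\mathbb{R}^{n\times n}$ be a graph shift operator with eigendecomposition $S=V\Lambda V^\top$, $V=[v_1,\dots,v_n]$ orthogonal, $\Lambda=\mathrm{diag}(\lambda_1,\dots,\lambda_n)$. Let $\Phi^{(0)},\dots,\Phi^{(K)}$ be the parameter matrices of a shift-invariant edge varying graph filter (SI-EdgeGF), i.e. for each $k$, $\Phi^{(k)}=V\,\mathrm{diag}(\phi^{(k)}_1,\dots,\phi^{(k)}_n)\,V^{-1}$ for some real numbers $\phi_i^{(k)}$, and $[\Phi^{(k)}]_{ij}=0$ whenever $[S+I]_{ij}=0$. For a matrix $M\in\mathbb{R}^{n\times n}$ and $x\in\mathbb{R}^n$ put $$H_{\rm SI}(x,M)=\sum_{k=0}^K\Phi^{(k)}M^kx .$$ Let $h_i(\lambda)=\sum_{k=0}^K\phi_i^{(k)}\lambda^k$, $i=1,\dots,n$, be the shift-invariant filter frequency response. Assume that it is integral Lipschitz with respect to $C_L>0$, i.e. for any $\lambda_1\neq\lambda_2$ and $i=1,\dots,n$, $$\Big|\frac{\lambda_1+\lambda_2}{2}\cdot\frac{h_i(\lambda_1)-h_i(\lambda_2)}{\lambda_1-\lambda_2}\Big|\le C_L ,$$ and that $|h_i(\lambda)|\le 1$ for $i=1,\dots,n$. Let $\widetilde S=S+ES+SE$, with $E\in\mathbb{R}^{n\times n}$ symmetric, be a relative perturbation of $S$ of size $\epsilon$, i.e. $\|E\|_2\le\epsilon$. Then for any $x\in\mathbb{R}^n$, $$\|H_{\rm SI}(x,S)-H_{\rm SI}(x,\widetilde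 S)\|_2\le C_{\rm SI}\,\|x\|_2\,\epsilon+\mathcal{O}(\epsilon^2),\qquad C_{\rm SI}=2\sqrt n\,C_L .$$
   Context: A graph has nodes $\{1,\dots,n\}$ and edge set $\mathcal{E}$; a graph shift operator is a real symmetric matrix $S\in\mathbb{R}^{n\times n}$ whose sparsity follows the graph: $[S]_{ij}\ne0$ iff $(i,j)\in\mathcal{E}$ or $i=j$. A graph signal is a vector $x\in\mathbb{R}^n$. $\|\cdot\|_2$ is the Euclidean norm on vectors and the spectral (operator) norm on matrices. The filter on the perturbed graph, $H_{\rm SI}(x,\widetilde S)$, uses the same matrices $\Phi^{(k)}$, with only the powers of $S$ replaced by powers of $\widetilde S$. $\mathcal{O}(\epsilon^2)$ denotes a quantity bounded in absolute value by $M\epsilon^2$ for all sufficiently small $\epsilon$, where $M$ may depend on $n$, $K$, $S$, the eigenvalues $\phi_i^{(k)}$ and $x$, but not on $E$. *)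

theory Defs
  imports "HOL-Analysis.Analysis"
begin

text \<open>
  The graph has the finite index type \<open>'n\<close> as its node set, so that \<open>n = CARD('n)\<close>.

  Two library operations on \<open>real^'n^'n\<close> do not mean what matrix notation suggests: \<open>A ^ k\<close> is the
  entrywise power, and \<open>norm A\<close> is the Frobenius norm. Hence the definitions of \<open>matrix_power\<close>
  and \<open>spectral_norm\<close>.
\<close>

primrec matrix_power :: "real^'n^'n \<Rightarrow> nat \<Rightarrow> real^'n^'n" where
  "matrix_power A 0 = mat 1"
| "matrix_power A (Suc k) = A ** matrix_power A k"

definition spectral_norm :: "real^'n^'n \<Rightarrow> real" where
  "spectral_norm A = onorm ((*v) A)"

definition symmetric_matrix :: "real^'n^'n \<Rightarrow> bool" where
  "symmetric_matrix A \<longleftrightarrow> transpose A = A"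

definition diag_matrix :: "('n \<Rightarrow> real) \<Rightarrow> real^'n^'n" where
  "diag_matrix d = (\<chi> i j. if i = j then d i else 0)"

definition graph_shift_operator :: "('n \<times> 'n) set \<Rightarrow> real^'n^'n \<Rightarrow> bool" where
  "graph_shift_operator \<E> S \<longleftrightarrow>
     symmetric_matrix S \<and> (\<forall>i j. S $ i $ j \<noteq> 0 \<longleftrightarrow> (i, j) \<in> \<E> \<or> i = j)"

definition eigendecomposition :: "real^'n^'n \<Rightarrow> real^'n^'n \<Rightarrow> ('n \<Rightarrow> real) \<Rightarrow> bool" where
  "eigendecomposition S V \<mu> \<longleftrightarrow>
     orthogonal_matrix V \<and> S = V ** diag_matrix \<mu> ** transpose V"

text \<open>The support condition confines each parameter matrix to the edges of the graph and the
  diagonal.\<close>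

definition si_edge_gf ::
  "real^'n^'n \<Rightarrow> real^'n^'n \<Rightarrow> nat \<Rightarrow> (nat \<Rightarrow> 'n \<Rightarrow> real) \<Rightarrow> (nat \<Rightarrow> real^'n^'n) \<Rightarrow> bool" where
  "si_edge_gf S V K \<phi> \<Phi> \<longleftrightarrow>
     (\<forall>k\<le>K. \<Phi> k = V ** diag_matrix (\<phi> k) ** matrix_inv V \<and>
        (\<forall>i j. (S + mat 1) $ i $ j = 0 \<longrightarrow> \<Phi> k $ i $ j = 0))"

definition H_SI :: "nat \<Rightarrow> (nat \<Rightarrow> real^'n^'n) \<Rightarrow> real^'n \<Rightarrow> real^'n^'n \<Rightarrow> real^'n" where
  "H_SI K \<Phi> x A = (\<Sum>k\<le>K. (\<Phi> k ** matrix_power A k) *v x)"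

definition frequency_response :: "nat \<Rightarrow> (nat \<Rightarrow> 'n \<Rightarrow> real) \<Rightarrow> 'n \<Rightarrow> real \<Rightarrow> real" where
  "frequency_response K \<phi> i l = (\<Sum>k\<le>K. \<phi> k i * l ^ k)"

text \<open>The set \<open>D\<close> is the range of graph frequencies. It is a parameter because on
  \<open>D = UNIV\<close> only constant polynomials are integral Lipschitz.\<close>

definition integral_lipschitz_on :: "real set \<Rightarrow> real \<Rightarrow> (real \<Rightarrow> real) \<Rightarrow> bool" where
  "integral_lipschitz_on D C h \<longleftrightarrow>
     (\<forall>l1\<in>D. \<forall>l2\<in>D. l1 \<noteq> l2 \<longrightarrow> \<bar>(l1 + l2) / 2 * ((h l1 - h l2) / (l1 - l2))\<bar> \<le> C)"

end

theory Submission
  imports Defs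
begin

text \<open>
  In the eigenbasis of \<open>S\<close>, put \<open>F = V\<^sup>T E V\<close> and \<open>y = V\<^sup>T x\<close>. The part of the filter difference that
  is linear in \<open>E\<close> has \<open>p\<close>-th component \<open>\<Sum>q. (\<mu> p + \<mu> q) h\<^sub>p[\<mu> p, \<mu> q] F\<^sub>p\<^sub>q y\<^sub>q\<close>, where \<open>h\<^sub>p[a, b]\<close> is the
  divided difference of the \<open>p\<close>-th frequency response. The integral Lipschitz condition bounds
  \<open>\<bar>(a + b) h\<^sub>p[a, b]\<bar>\<close> by \<open>2 C_L\<close>, also for \<open>a = b\<close> by continuity, so by Cauchy--Schwarz the linear
  part has norm at most \<open>2 C_L\<close> times the Frobenius norm of \<open>F\<close> times \<open>norm y\<close>, and the Frobenius
  norm is at most \<open>sqrt n\<close> times the spectral norm.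
\<close>

section \<open>Spectral norm\<close>

lemma norm_mult_le_spectral_norm: "norm (A *v x) \<le> spectral_norm A * norm x"
  unfolding spectral_norm_def by (rule onorm[OF matrix_vector_mul_bounded_linear])

lemma spectral_norm_nonneg: "0 \<le> spectral_norm A"
  unfolding spectral_norm_def by (rule onorm_pos_le[OF matrix_vector_mul_bounded_linear])

lemma spectral_norm_le:
  assumes "\<And>x. norm (A *v x) \<le> c * norm x"
  shows "spectral_norm A \<le> c"
  unfolding spectral_norm_def by (rule onorm_le) (rule assms)

lemma spectral_norm_mult: "spectral_norm (A ** B) \<le> spectral_norm A * spectral_norm B"
proof (rule spectral_norm_le)
  fix x
  have "norm ((A ** B) *v x) = norm (A *v (B *v x))"
    by (simp add: matrix_vector_mul_assoc)
  also have "\<dots> \<le> spectral_norm A * (spectral_norm B * norm x)"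
    by (rule order_trans[OF norm_mult_le_spectral_norm])
      (intro mult_left_mono norm_mult_le_spectral_norm spectral_norm_nonneg)
  finally show "norm ((A ** B) *v x) \<le> spectral_norm A * spectral_norm B * norm x"
    by (simp add: mult.assoc)
qed

lemma spectral_norm_add: "spectral_norm (A + B) \<le> spectral_norm A + spectral_norm B"
proof (rule spectral_norm_le)
  fix x
  have "norm ((A + B) *v x) \<le> norm (A *v x) + norm (B *v x)"
    by (simp add: matrix_vector_mult_add_rdistrib norm_triangle_ineq)
  also have "\<dots> \<le> spectral_norm A * norm x + spectral_norm B * norm x"
    by (intro add_mono norm_mult_le_spectral_norm)
  finally show "norm ((A + B) *v x) \<le> (spectral_norm A + spectral_norm B) * norm x"
    by (simp add: distrib_right)
qed

lemma norm_orthogonal_matrix_mult: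
  fixes V :: "real^'n^'n"
  assumes "orthogonal_matrix V"
  shows "norm (V *v x) = norm x"
proof -
  have "orthogonal_transformation ((*v) V)"
    using assms orthogonal_transformation_matrix by fastforce
  thus ?thesis
    by (rule orthogonal_transformation_norm)
qed

text \<open>Both \<open>V\<close> and \<open>transpose V\<close> are isometries. This carries the
  bound on \<open>E\<close> over to its form in the eigenbasis.\<close>

lemma spectral_norm_conjugate_le:
  assumes "orthogonal_matrix V"
  shows "spectral_norm (transpose V ** E ** V) \<le> spectral_norm E"
proof (rule spectral_norm_le)
  fix x
  have "norm ((transpose V ** E ** V) *v x) = norm (transpose V *v (E *v (V *v x)))"
    by (simp add: matrix_vector_mul_assoc matrix_mul_assoc)
  also have "\<dots> = norm (E *v (V *v x))"
    using assms by (simp add: norm_orthogonal_matrix_mult del: transpose_matrix_vector)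
  also have "\<dots> \<le> spectral_norm E * norm x"
    using norm_mult_le_spectral_norm[of E "V *v x"] assms
    by (simp add: norm_orthogonal_matrix_mult)
  finally show "norm ((transpose V ** E ** V) *v x) \<le> spectral_norm E * norm x" .
qed

text \<open>Every column of \<open>F\<close> is the image of a unit vector, and there are
  \<open>CARD('n)\<close> columns. This is the source of the factor \<open>sqrt n\<close> in the
  final constant.\<close>

lemma sum_squares_le_spectral_norm:
  fixes F :: "real^'n^'n"
  shows "(\<Sum>p\<in>UNIV. \<Sum>q\<in>UNIV. (F $ p $ q)\<^sup>2) \<le> real CARD('n) * (spectral_norm F)\<^sup>2"
proof -
  have "(\<Sum>p\<in>UNIV. (F $ p $ q)\<^sup>2) \<le> (spectral_norm F)\<^sup>2" for q
  proof -
    have "norm (column q F) \<le> spectral_norm F"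
      using norm_mult_le_spectral_norm[of F "axis q 1"]
      by (simp add: matrix_vector_mult_basis)
    hence "(norm (column q F))\<^sup>2 \<le> (spectral_norm F)\<^sup>2"
      by (simp add: power_mono)
    thus ?thesis
      by (simp add: norm_vec_def L2_set_def sum_nonneg column_def)
  qed
  hence "(\<Sum>q\<in>UNIV. \<Sum>p\<in>UNIV. (F $ p $ q)\<^sup>2) \<le> (\<Sum>q\<in>(UNIV::'n set). (spectral_norm F)\<^sup>2)"
    by (rule sum_mono)
  thus ?thesis
    by (subst sum.swap) simp
qed

text \<open>The vector on the left is the entrywise product of \<open>G\<close> and \<open>F\<close>
  applied to \<open>y\<close>. Cauchy-Schwarz in each row leads to the Frobenius norm, which, unlike
  the spectral norm, grows by at most the factor \<open>c\<close> when entries are multiplied by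
  numbers of modulus at most \<open>c\<close>.\<close>

lemma norm_hadamard_mult_le:
  fixes F G :: "real^'n^'n" and y :: "real^'n"
  assumes G: "\<And>p q. \<bar>G $ p $ q\<bar> \<le> c" and c: "0 \<le> c"
  shows "norm (\<chi> p. \<Sum>q\<in>UNIV. G $ p $ q * F $ p $ q * y $ q)
           \<le> c * sqrt (real CARD('n)) * spectral_norm F * norm y"
proof -
  let ?z = "\<lambda>p. \<Sum>q\<in>UNIV. G $ p $ q * F $ p $ q * y $ q"
  have y: "(norm y)\<^sup>2 = (\<Sum>q\<in>UNIV. (y $ q)\<^sup>2)"
    by (simp add: norm_vec_def L2_set_def sum_nonneg)
  have "(?z p)\<^sup>2 \<le> c\<^sup>2 * (\<Sum>q\<in>UNIV. (F $ p $ q)\<^sup>2) * (norm y)\<^sup>2" for p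
  proof -
    have "(?z p)\<^sup>2 \<le> (\<Sum>q\<in>UNIV. (G $ p $ q * F $ p $ q)\<^sup>2) * (\<Sum>q\<in>UNIV. (y $ q)\<^sup>2)"
      by (rule Cauchy_Schwarz_ineq_sum)
    also have "\<dots> \<le> (\<Sum>q\<in>UNIV. c\<^sup>2 * (F $ p $ q)\<^sup>2) * (\<Sum>q\<in>UNIV. (y $ q)\<^sup>2)"
    proof (intro mult_right_mono sum_mono sum_nonneg zero_le_power2)
      fix q
      have "(G $ p $ q)\<^sup>2 \<le> c\<^sup>2"
        using G c by (simp add: abs_le_square_iff[symmetric])
      thus "(G $ p $ q * F $ p $ q)\<^sup>2 \<le> c\<^sup>2 * (F $ p $ q)\<^sup>2"
        by (simp add: power_mult_distrib mult_right_mono)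
    qed
    finally show ?thesis
      by (simp add: y sum_distrib_left)
  qed
  hence "(\<Sum>p\<in>UNIV. (?z p)\<^sup>2) \<le> (\<Sum>p\<in>UNIV. c\<^sup>2 * (\<Sum>q\<in>UNIV. (F $ p $ q)\<^sup>2) * (norm y)\<^sup>2)"
    by (rule sum_mono)
  also have "\<dots> = c\<^sup>2 * (\<Sum>p\<in>UNIV. \<Sum>q\<in>UNIV. (F $ p $ q)\<^sup>2) * (norm y)\<^sup>2"
    by (simp add: sum_distrib_left sum_distrib_right)
  also have "\<dots> \<le> c\<^sup>2 * (real CARD('n) * (spectral_norm F)\<^sup>2) * (norm y)\<^sup>2"
    by (intro mult_right_mono mult_left_mono sum_squares_le_spectral_norm zero_le_power2)
  also have "\<dots> = (c * sqrt (real CARD('n)) * spectral_norm F * norm y)\<^sup>2"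
    by (simp add: power_mult_distrib)
  finally have "(norm (\<chi> p. ?z p))\<^sup>2 \<le> (c * sqrt (real CARD('n)) * spectral_norm F * norm y)\<^sup>2"
    by (simp add: norm_vec_def L2_set_def sum_nonneg)
  thus ?thesis
    by (rule power2_le_imp_le) (simp add: c spectral_norm_nonneg)
qed

section \<open>First-order expansion of matrix powers\<close>

text \<open>The derivative of the \<open>k\<close>-th power at \<open>A\<close> in direction
  \<open>B\<close>, that is, the sum of A^j B A^(k-1-j) over j < k. The recursion is the product
  rule for A * A^k.\<close>

primrec matrix_power_deriv :: "real^'n^'n \<Rightarrow> real^'n^'n \<Rightarrow> nat \<Rightarrow> real^'n^'n" where
  "matrix_power_deriv A B 0 = 0"
| "matrix_power_deriv A B (Suc k) = A ** matrix_power_deriv A B k + B ** matrix_power A k"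

lemma norm_matrix_power_deriv_le:
  "\<exists>c\<ge>0. \<forall>B. norm (matrix_power_deriv A B k *v y) \<le> c * spectral_norm B"
proof (induction k)
  case 0
  show ?case by (intro exI[of _ 0]) simp
next
  case (Suc k)
  then obtain c where c: "c \<ge> 0" "\<And>B. norm (matrix_power_deriv A B k *v y) \<le> c * spectral_norm B"
    by blast
  let ?c = "spectral_norm A * c + norm (matrix_power A k *v y)"
  have "norm (matrix_power_deriv A B (Suc k) *v y) \<le> ?c * spectral_norm B" for B
  proof -
    have "norm (matrix_power_deriv A B (Suc k) *v y)
        \<le> norm (A *v (matrix_power_deriv A B k *v y)) + norm (B *v (matrix_power A k *v y))"
      by (simp add: matrix_vector_mult_add_rdistrib norm_triangle_ineq
          flip: matrix_vector_mul_assoc)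
    also have "\<dots> \<le> spectral_norm A * (c * spectral_norm B)
        + spectral_norm B * norm (matrix_power A k *v y)"
      by (intro add_mono order_trans[OF norm_mult_le_spectral_norm] mult_left_mono c
          spectral_norm_nonneg order_refl)
    finally show ?thesis by (simp add: algebra_simps)
  qed
  moreover have "?c \<ge> 0"
    using c by (simp add: spectral_norm_nonneg)
  ultimately show ?case by blast
qed

text \<open>Induction on \<open>k\<close>: the new error is \<open>B\<close> applied to a term
  linear in \<open>B\<close>, plus \<open>A + B\<close> applied to the old remainder. The
  restriction to \<open>spectral_norm B \<le> 1\<close> bounds the norm of \<open>A + B\<close>
  independently of \<open>B\<close>.\<close>

lemma norm_matrix_power_remainder_le:
  "\<exists>c\<ge>0. \<forall>B. spectral_norm B \<le> 1 \<longrightarrow>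
     norm (matrix_power (A + B) k *v y - matrix_power A k *v y - matrix_power_deriv A B k *v y)
       \<le> c * (spectral_norm B)\<^sup>2"
proof (induction k)
  case 0
  show ?case by (intro exI[of _ 0]) simp
next
  case (Suc k)
  let ?r = "\<lambda>k B. matrix_power (A + B) k *v y - matrix_power A k *v y - matrix_power_deriv A B k *v y"
  obtain c where c: "c \<ge> 0" "\<And>B. spectral_norm B \<le> 1 \<Longrightarrow> norm (?r k B) \<le> c * (spectral_norm B)\<^sup>2"
    using Suc by blast
  obtain d where d: "d \<ge> 0" "\<And>B. norm (matrix_power_deriv A B k *v y) \<le> d * spectral_norm B"
    using norm_matrix_power_deriv_le by blast
  let ?c = "d + (spectral_norm A + 1) * c"
  have "norm (?r (Suc k) B) \<le> ?c * (spectral_norm B)\<^sup>2" if B: "spectral_norm B \<le> 1" for B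
  proof -
    \<comment> \<open>Expanding (A + B) times the sum of the power and its derivative gives all
      terms of the next expansion and the single extra term \<open>B\<close> times the
      derivative.\<close>
    have "?r (Suc k) B = B *v (matrix_power_deriv A B k *v y) + (A + B) *v ?r k B"
      by (simp add: matrix_vector_mult_add_rdistrib matrix_vector_mult_diff_distrib
          flip: matrix_vector_mul_assoc)
    hence "norm (?r (Suc k) B)
        \<le> norm (B *v (matrix_power_deriv A B k *v y)) + norm ((A + B) *v ?r k B)"
      by (simp only: norm_triangle_ineq)
    also have "\<dots> \<le> spectral_norm B * (d * spectral_norm B)
        + (spectral_norm A + 1) * (c * (spectral_norm B)\<^sup>2)"
    proof (rule add_mono)
      show "norm (B *v (matrix_power_deriv A B k *v y)) \<le> spectral_norm B * (d * spectral_norm B)"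
        by (intro order_trans[OF norm_mult_le_spectral_norm] mult_left_mono d spectral_norm_nonneg)
      have "spectral_norm (A + B) \<le> spectral_norm A + 1"
        using spectral_norm_add[of A B] B by simp
      thus "norm ((A + B) *v ?r k B) \<le> (spectral_norm A + 1) * (c * (spectral_norm B)\<^sup>2)"
        by (intro order_trans[OF norm_mult_le_spectral_norm] mult_mono c B norm_ge_zero)
          (simp_all add: spectral_norm_nonneg add_nonneg_nonneg)
    qed
    finally show ?thesis by (simp add: algebra_simps power2_eq_square)
  qed
  moreover have "?c \<ge> 0"
    using c d by (simp add: spectral_norm_nonneg)
  ultimately show ?case by blast
qed

section \<open>Divided differences\<close>

text \<open>The divided difference of t^k, that is, the sum of a^j b^(k-1-j) over j < k. Being free
  of division, it also makes sense for \<open>a = b\<close>, and its recursion parallels that of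
  \<open>matrix_power_deriv\<close>.\<close>

primrec power_divdiff :: "nat \<Rightarrow> real \<Rightarrow> real \<Rightarrow> real" where
  "power_divdiff 0 a b = 0"
| "power_divdiff (Suc k) a b = a * power_divdiff k a b + b ^ k"

lemma power_divdiff_eq: "(a - b) * power_divdiff k a b = a ^ k - b ^ k"
proof (induction k)
  case (Suc k)
  have "(a - b) * power_divdiff (Suc k) a b = a * ((a - b) * power_divdiff k a b) + (a - b) * b ^ k"
    by (simp add: algebra_simps)
  thus ?case unfolding Suc by (simp add: algebra_simps)
qed simp

lemma continuous_on_power_divdiff: "continuous_on T (power_divdiff k a)"
  by (induction k) (auto intro!: continuous_intros)

lemma integral_lipschitz_divdiff_le:
  assumes D: "is_interval D" "interior D \<noteq> {}" and ab: "a \<in> D" "b \<in> D"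
    and L: "integral_lipschitz_on D C (frequency_response K \<phi> i)"
  shows "\<bar>(a + b) * (\<Sum>k\<le>K. \<phi> k i * power_divdiff k a b)\<bar> \<le> 2 * C"
proof -
  define g where "g = (\<lambda>b. (a + b) * (\<Sum>k\<le>K. \<phi> k i * power_divdiff k a b))"
  have off: "norm (g b) \<le> 2 * C" if "b \<in> D - {a}" for b
  proof -
    have "(a - b) * (\<Sum>k\<le>K. \<phi> k i * power_divdiff k a b)
        = (\<Sum>k\<le>K. \<phi> k i * ((a - b) * power_divdiff k a b))"
      by (simp add: sum_distrib_left algebra_simps)
    also have "\<dots> = frequency_response K \<phi> i a - frequency_response K \<phi> i b"
      by (simp only: power_divdiff_eq frequency_response_def sum_subtractf[symmetric]
          right_diff_distrib)
    finally have "(\<Sum>k\<le>K. \<phi> k i * power_divdiff k a b)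
        = (frequency_response K \<phi> i a - frequency_response K \<phi> i b) / (a - b)"
      using that by (simp add: field_simps)
    moreover have "\<bar>(a + b) / 2 * ((frequency_response K \<phi> i a - frequency_response K \<phi> i b) / (a - b))\<bar> \<le> C"
      using L that ab unfolding integral_lipschitz_on_def by auto
    \<comment> \<open>The hypothesis contains the mean of \<open>a\<close> and \<open>b\<close>,
      here their sum appears; hence the bound \<open>2 * C\<close>.\<close>
    moreover have "g b = 2 * ((a + b) / 2 * (\<Sum>k\<le>K. \<phi> k i * power_divdiff k a b))"
      by (simp add: g_def)
    ultimately show ?thesis
      by (simp only: abs_mult real_norm_def)
  qed
  \<comment> \<open>For \<open>b = a\<close> the bound is a limit of the bounds for
    \<open>b \<noteq> a\<close>. Nonempty interior rules out a singleton, so by connectedness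
    \<open>a\<close> is a limit point of \<open>D\<close>.\<close>
  have "D \<noteq> {a}"
    using D by auto
  hence "a islimpt D"
    using D ab by (intro connected_imp_perfect) (auto simp: is_interval_connected)
  hence "a \<in> closure (D - {a})"
    by (simp add: islimpt_in_closure)
  moreover have "continuous_on (closure (D - {a})) g"
    unfolding g_def
    by (intro continuous_intros continuous_on_power_divdiff)
  ultimately have "norm (g a) \<le> 2 * C"
    using off by (intro continuous_on_closure_norm_le[of "D - {a}" g]) auto
  hence "norm (g b) \<le> 2 * C"
    using off ab by (cases "b = a") auto
  thus ?thesis by (simp add: g_def)
qed

section \<open>The filter in the eigenbasis\<close>

lemma diag_matrix_mult_vec: "(diag_matrix d *v x) $ p = d p * x $ p"
  by (simp add: diag_matrix_def matrix_vector_mult_def if_distrib[of "\<lambda>u. u * _"] cong: if_cong)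

lemma matrix_power_diag_mult_vec: "(matrix_power (diag_matrix \<mu>) k *v y) $ p = \<mu> p ^ k * y $ p"
  by (induction k)
    (simp_all add: diag_matrix_mult_vec mult.assoc flip: matrix_vector_mul_assoc)

text \<open>The direction has the entries (\<mu> p + \<mu> q) F_pq. The diagonal powers to its left
  and right contribute (\<mu> p)^j (\<mu> q)^(k-1-j), and these sum to the divided
  difference.\<close>

lemma matrix_power_deriv_diag:
  fixes F :: "real^'n^'n"
  shows "(matrix_power_deriv (diag_matrix \<mu>) (F ** diag_matrix \<mu> + diag_matrix \<mu> ** F) k *v y) $ p
    = (\<Sum>q\<in>UNIV. (\<mu> p + \<mu> q) * power_divdiff k (\<mu> p) (\<mu> q) * F $ p $ q * y $ q)"
proof (induction k)
  case (Suc k)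
  let ?B = "F ** diag_matrix \<mu> + diag_matrix \<mu> ** F"
  have F: "(F *v u) $ p = (\<Sum>q\<in>UNIV. F $ p $ q * u $ q)" for u
    by (simp add: matrix_vector_mult_def)
  have "(?B *v (matrix_power (diag_matrix \<mu>) k *v y)) $ p
      = (\<Sum>q\<in>UNIV. (\<mu> p + \<mu> q) * \<mu> q ^ k * F $ p $ q * y $ q)"
    by (simp add: matrix_vector_mult_add_rdistrib diag_matrix_mult_vec matrix_power_diag_mult_vec F
        sum_distrib_left algebra_simps flip: matrix_vector_mul_assoc sum.distrib)
  hence "(matrix_power_deriv (diag_matrix \<mu>) ?B (Suc k) *v y) $ p
      = \<mu> p * (\<Sum>q\<in>UNIV. (\<mu> p + \<mu> q) * power_divdiff k (\<mu> p) (\<mu> q) * F $ p $ q * y $ q)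
        + (\<Sum>q\<in>UNIV. (\<mu> p + \<mu> q) * \<mu> q ^ k * F $ p $ q * y $ q)"
    by (simp only: matrix_power_deriv.simps matrix_vector_mult_add_rdistrib vector_add_component
        diag_matrix_mult_vec Suc flip: matrix_vector_mul_assoc)
  thus ?case
    by (simp add: sum_distrib_left algebra_simps flip: sum.distrib)
qed simp

lemma matrix_power_conjugate:
  assumes "orthogonal_matrix V"
  shows "matrix_power (V ** A ** transpose V) k = V ** matrix_power A k ** transpose V"
proof (induction k)
  case 0
  show ?case using assms by (simp add: orthogonal_matrix_def)
next
  case (Suc k)
  have "matrix_power (V ** A ** transpose V) (Suc k)
      = V ** A ** (transpose V ** V) ** matrix_power A k ** transpose V"
    by (simp add: Suc matrix_mul_assoc)
  also have "transpose V ** V = mat 1"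
    using assms by (simp add: orthogonal_matrix)
  finally show ?case by (simp add: matrix_mul_assoc)
qed

lemma matrix_inv_orthogonal:
  fixes V :: "real^'n^'n"
  assumes "orthogonal_matrix V"
  shows "matrix_inv V = transpose V"
proof -
  have V: "V ** transpose V = mat 1" "transpose V ** V = mat 1"
    using assms by (simp_all add: orthogonal_matrix_def)
  \<comment> \<open>\<open>matrix_inv\<close> chooses some two-sided inverse;
    \<open>transpose V\<close> witnesses that one exists. Uniqueness of inverses then identifies the
    two.\<close>
  have "matrix_inv V ** V = mat 1"
    unfolding matrix_inv_def by (rule someI2[where a = "transpose V" and Q = "\<lambda>W. W ** V = mat 1"]) (auto simp: V)
  hence "matrix_inv V ** (V ** transpose V) = transpose V"
    by (simp add: matrix_mul_assoc)
  thus ?thesis by (simp add: V)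
qed

text \<open>All parameter matrices are diagonal in the basis \<open>V\<close>, so the inner factors
  \<open>transpose V ** V\<close> cancel. \<open>A\<close> is arbitrary because the perturbed shift
  is in general not diagonal in this basis.\<close>

lemma H_SI_conjugate:
  assumes V: "orthogonal_matrix V" and \<Phi>: "si_edge_gf S V K \<phi> \<Phi>"
  shows "H_SI K \<Phi> x (V ** A ** transpose V)
    = V *v (\<Sum>k\<le>K. diag_matrix (\<phi> k) *v (matrix_power A k *v (transpose V *v x)))"
proof -
  have "(\<Phi> k ** matrix_power (V ** A ** transpose V) k) *v x
      = V *v (diag_matrix (\<phi> k) *v (matrix_power A k *v (transpose V *v x)))" if "k \<le> K" for k
  proof -
    have "\<Phi> k ** matrix_power (V ** A ** transpose V) k
        = V ** diag_matrix (\<phi> k) ** (transpose V ** V) ** matrix_power A k ** transpose V"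
      using that V \<Phi>
      by (simp add: si_edge_gf_def matrix_inv_orthogonal matrix_power_conjugate matrix_mul_assoc)
    also have "\<dots> = V ** diag_matrix (\<phi> k) ** matrix_power A k ** transpose V"
      using V by (simp add: orthogonal_matrix)
    finally show ?thesis
      by (simp add: matrix_vector_mul_assoc matrix_mul_assoc del: transpose_matrix_vector)
  qed
  thus ?thesis
    by (simp add: H_SI_def linear_sum[OF matrix_vector_mul_linear])
qed

lemma norm_filter_deriv_le:
  fixes F :: "real^'n^'n" and y :: "real^'n" and \<mu> :: "'n \<Rightarrow> real"
  assumes D: "is_interval D" "interior D \<noteq> {}" "\<And>i. \<mu> i \<in> D" and C: "0 \<le> C"
    and L: "\<And>i. integral_lipschitz_on D C (frequency_response K \<phi> i)"
  shows "norm (\<Sum>k\<le>K. diag_matrix (\<phi> k) *v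
      (matrix_power_deriv (diag_matrix \<mu>) (F ** diag_matrix \<mu> + diag_matrix \<mu> ** F) k *v y))
    \<le> 2 * C * sqrt (real CARD('n)) * spectral_norm F * norm y"
proof -
  \<comment> \<open>Summing over \<open>k\<close> with the weights \<open>\<phi> k p\<close> turns
    divided differences of powers into those of the \<open>p\<close>-th frequency response.\<close>
  define G :: "real^'n^'n" where
    "G = (\<chi> p q. (\<mu> p + \<mu> q) * (\<Sum>k\<le>K. \<phi> k p * power_divdiff k (\<mu> p) (\<mu> q)))"
  have "(\<Sum>k\<le>K. diag_matrix (\<phi> k) *v
      (matrix_power_deriv (diag_matrix \<mu>) (F ** diag_matrix \<mu> + diag_matrix \<mu> ** F) k *v y)) $ p
    = (\<Sum>q\<in>UNIV. G $ p $ q * F $ p $ q * y $ q)" for p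
    unfolding sum_component diag_matrix_mult_vec matrix_power_deriv_diag
    by (simp add: G_def sum_distrib_left sum_distrib_right sum.swap[of _ _ UNIV] algebra_simps)
  hence "(\<Sum>k\<le>K. diag_matrix (\<phi> k) *v
      (matrix_power_deriv (diag_matrix \<mu>) (F ** diag_matrix \<mu> + diag_matrix \<mu> ** F) k *v y))
    = (\<chi> p. \<Sum>q\<in>UNIV. G $ p $ q * F $ p $ q * y $ q)"
    by (simp add: vec_eq_iff)
  moreover have "\<bar>G $ p $ q\<bar> \<le> 2 * C" for p q
    using integral_lipschitz_divdiff_le[OF D(1,2) D(3) D(3) L] by (simp add: G_def)
  ultimately show ?thesis
    using norm_hadamard_mult_le[of G "2 * C" F y] C by simp
qed

text \<open>The constants for the single powers are added up, weighted by
  \<open>spectral_norm (\<Psi> k)\<close>. The order of quantifiers matters: \<open>c\<close> is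
  chosen before \<open>B\<close>.\<close>

lemma norm_filter_remainder_le:
  fixes A :: "real^'n^'n" and \<Psi> :: "nat \<Rightarrow> real^'n^'n"
  obtains c where "c \<ge> 0"
    and "\<And>B. spectral_norm B \<le> 1 \<Longrightarrow>
      norm (\<Sum>k\<le>K. \<Psi> k *v (matrix_power (A + B) k *v y - matrix_power A k *v y
        - matrix_power_deriv A B k *v y)) \<le> c * (spectral_norm B)\<^sup>2"
proof -
  let ?r = "\<lambda>k B. matrix_power (A + B) k *v y - matrix_power A k *v y - matrix_power_deriv A B k *v y"
  obtain d where d: "\<And>k. d k \<ge> 0"
    "\<And>k B. spectral_norm B \<le> 1 \<Longrightarrow> norm (?r k B) \<le> d k * (spectral_norm B)\<^sup>2"
    using norm_matrix_power_remainder_le[of A _ y] by metis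
  show thesis
  proof
    show "(\<Sum>k\<le>K. spectral_norm (\<Psi> k) * d k) \<ge> 0"
      using d by (simp add: sum_nonneg spectral_norm_nonneg)
  next
    fix B :: "real^'n^'n"
    assume "spectral_norm B \<le> 1"
    hence "norm (\<Psi> k *v ?r k B) \<le> spectral_norm (\<Psi> k) * d k * (spectral_norm B)\<^sup>2" for k
      using order_trans[OF norm_mult_le_spectral_norm mult_left_mono[OF d(2) spectral_norm_nonneg]]
      by (simp add: mult.assoc)
    thus "norm (\<Sum>k\<le>K. \<Psi> k *v ?r k B) \<le> (\<Sum>k\<le>K. spectral_norm (\<Psi> k) * d k) * (spectral_norm B)\<^sup>2"
      unfolding sum_distrib_right by (intro sum_norm_le) blast
  qed
qed

lemma matrix_add_rdistrib: "(A + B) ** C = A ** C + B ** C"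
  by (simp add: matrix_matrix_mult_def vec_eq_iff distrib_right sum.distrib)

text \<open>Inserting \<open>V ** transpose V\<close> on the outer side of \<open>E\<close> shows
  that the perturbation keeps its relative form in the eigenbasis, with \<open>F\<close> in place of
  \<open>E\<close>.\<close>

lemma relative_perturbation_conjugate:
  fixes S V A E :: "real^'n^'n"
  assumes "orthogonal_matrix V" and S: "S = V ** A ** transpose V"
  defines "F \<equiv> transpose V ** E ** V"
  shows "S + E ** S + S ** E = V ** (A + (F ** A + A ** F)) ** transpose V"
proof -
  have "E ** S = (V ** transpose V) ** E ** S" "S ** E = S ** E ** (V ** transpose V)"
    using assms(1) by (simp_all add: orthogonal_matrix_def)
  thus ?thesis
    by (simp add: S F_def matrix_add_ldistrib matrix_add_rdistrib matrix_mul_assoc)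
qed

section \<open>Assembly of the first-order term and the remainder\<close>

theorem theorem1:
  fixes \<E> :: "('n::finite \<times> 'n) set"
    and S V :: "real^'n^'n"
    and \<mu> :: "'n \<Rightarrow> real"
    and K :: nat
    and \<phi> :: "nat \<Rightarrow> 'n \<Rightarrow> real"
    and \<Phi> :: "nat \<Rightarrow> real^'n^'n"
    and D :: "real set"
    and C_L :: real
  assumes "graph_shift_operator \<E> S"
    and "eigendecomposition S V \<mu>"
    and "si_edge_gf S V K \<phi> \<Phi>"
    and "is_interval D" and "interior D \<noteq> {}" and "\<And>i. \<mu> i \<in> D"
    and "C_L > 0"
    and "\<And>i. integral_lipschitz_on D C_L (frequency_response K \<phi> i)"
    and "\<And>i l. l \<in> D \<Longrightarrow> \<bar>frequency_response K \<phi> i l\<bar> \<le> 1"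
  shows "\<forall>x::real^'n. \<exists>M. \<exists>\<epsilon>0>0. \<forall>\<epsilon>\<le>\<epsilon>0. \<forall>E::real^'n^'n.
           symmetric_matrix E \<and> spectral_norm E \<le> \<epsilon> \<longrightarrow>
             norm (H_SI K \<Phi> x S - H_SI K \<Phi> x (S + E ** S + S ** E))
               \<le> (2 * sqrt (real CARD('n)) * C_L) * norm x * \<epsilon> + M * \<epsilon>\<^sup>2"
proof
  fix x :: "real^'n"
  have V: "orthogonal_matrix V" and S: "S = V ** diag_matrix \<mu> ** transpose V"
    using assms(2) by (auto simp: eigendecomposition_def)
  define A where "A = diag_matrix \<mu>"
  define y where "y = transpose V *v x"
  define s where "s = spectral_norm A"
  have y: "norm y = norm x"
    using V by (simp add: y_def norm_orthogonal_matrix_mult del: transpose_matrix_vector)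
  have s: "s \<ge> 0"
    by (simp add: s_def spectral_norm_nonneg)
  obtain c where c: "c \<ge> 0" "\<And>B. spectral_norm B \<le> 1 \<Longrightarrow>
      norm (\<Sum>k\<le>K. diag_matrix (\<phi> k) *v (matrix_power (A + B) k *v y - matrix_power A k *v y
        - matrix_power_deriv A B k *v y)) \<le> c * (spectral_norm B)\<^sup>2"
    by (rule norm_filter_remainder_le[where K = K and \<Psi> = "\<lambda>k. diag_matrix (\<phi> k)" and A = A and y = y])
      blast
  \<comment> \<open>The direction \<open>B\<close> below has norm at most
    \<open>2 * s * \<epsilon>\<close>, which explains both \<open>M = c * (2 * s)\<^sup>2\<close>
    and the threshold. The summand 1 in the threshold covers \<open>s = 0\<close>. Neither depends
    on \<open>E\<close>.\<close>
  have "norm (H_SI K \<Phi> x S - H_SI K \<Phi> x (S + E ** S + S ** E))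
      \<le> (2 * sqrt (real CARD('n)) * C_L) * norm x * \<epsilon> + c * (2 * s)\<^sup>2 * \<epsilon>\<^sup>2"
    if \<epsilon>: "\<epsilon> \<le> 1 / (2 * s + 1)" and E: "spectral_norm E \<le> \<epsilon>" for \<epsilon> and E :: "real^'n^'n"
  proof -
    define F where "F = transpose V ** E ** V"
    define B where "B = F ** A + A ** F"
    have F: "spectral_norm F \<le> \<epsilon>"
      using spectral_norm_conjugate_le[OF V, of E] E by (simp add: F_def)
    have "spectral_norm B \<le> spectral_norm F * s + s * spectral_norm F"
      unfolding B_def s_def
      by (intro order_trans[OF spectral_norm_add] add_mono spectral_norm_mult)
    also have "\<dots> \<le> 2 * s * \<epsilon>"
      using mult_left_mono[OF F s] by (simp add: algebra_simps)
    finally have B: "spectral_norm B \<le> 2 * s * \<epsilon>" .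
    \<comment> \<open>The statement also ranges over negative \<open>\<epsilon>\<close>, for which
      no \<open>E\<close> qualifies.\<close>
    have \<epsilon>0: "\<epsilon> \<ge> 0"
      using E spectral_norm_nonneg[of E] by simp
    have "(2 * s + 1) * \<epsilon> \<le> 1"
      using \<epsilon> s by (simp add: field_simps)
    hence B1: "spectral_norm B \<le> 1"
      using B \<epsilon>0 by (simp add: algebra_simps)
    let ?d = "\<Sum>k\<le>K. diag_matrix (\<phi> k) *v (matrix_power_deriv A B k *v y)"
    let ?r = "\<Sum>k\<le>K. diag_matrix (\<phi> k) *v (matrix_power (A + B) k *v y - matrix_power A k *v y
        - matrix_power_deriv A B k *v y)"
    have filter: "H_SI K \<Phi> x (V ** A' ** transpose V)
        = V *v (\<Sum>k\<le>K. diag_matrix (\<phi> k) *v (matrix_power A' k *v y))" for A'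
      unfolding y_def by (rule H_SI_conjugate[OF V assms(3)])
    have shift: "S = V ** A ** transpose V" "S + E ** S + S ** E = V ** (A + B) ** transpose V"
      using S relative_perturbation_conjugate[OF V S, of E] by (simp_all only: A_def B_def F_def)
    \<comment> \<open>The zeroth-order terms cancel, leaving the linear part \<open>?d\<close> and
      the quadratic remainder \<open>?r\<close>.\<close>
    have "H_SI K \<Phi> x (S + E ** S + S ** E) - H_SI K \<Phi> x S = V *v (?d + ?r)"
      unfolding shift(2) unfolding shift(1) filter matrix_vector_mult_diff_distrib[symmetric]
      by (simp add: matrix_vector_mult_diff_distrib sum_subtractf)
    hence "norm (H_SI K \<Phi> x S - H_SI K \<Phi> x (S + E ** S + S ** E)) = norm (V *v (?d + ?r))"
      by (subst norm_minus_commute) (rule arg_cong)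
    also have "\<dots> = norm (?d + ?r)"
      by (rule norm_orthogonal_matrix_mult[OF V])
    also have "\<dots> \<le> norm ?d + norm ?r"
      by (rule norm_triangle_ineq)
    \<comment> \<open>Only this term contributes to the coefficient of
      \<open>\<epsilon>\<close>.\<close>
    also have "norm ?d \<le> 2 * C_L * sqrt (real CARD('n)) * spectral_norm F * norm y"
      unfolding A_def B_def using assms(7)
      by (intro norm_filter_deriv_le[OF assms(4-6) _ assms(8)]) simp
    also have "\<dots> \<le> 2 * C_L * sqrt (real CARD('n)) * \<epsilon> * norm y"
      using F assms(7) by (intro mult_right_mono mult_left_mono) auto
    also have "norm ?r \<le> c * (2 * s * \<epsilon>)\<^sup>2"
      using c(2)[OF B1] power_mono[OF B spectral_norm_nonneg, of 2]
      by (meson c(1) mult_left_mono order_trans)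
    finally show ?thesis
      by (simp add: y power_mult_distrib algebra_simps)
  qed
  moreover have "1 / (2 * s + 1) > 0"
    using s by simp
  ultimately show "\<exists>M. \<exists>\<epsilon>0>0. \<forall>\<epsilon>\<le>\<epsilon>0. \<forall>E::real^'n^'n.
      symmetric_matrix E \<and> spectral_norm E \<le> \<epsilon> \<longrightarrow>
        norm (H_SI K \<Phi> x S - H_SI K \<Phi> x (S + E ** S + S ** E))
          \<le> (2 * sqrt (real CARD('n)) * C_L) * norm x * \<epsilon> + M * \<epsilon>\<^sup>2"
    by blast
qed

end
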